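(* Let $I\subseteq\mathbb{R}$ be an interval, $n\in\mathbb{N}$, $\mathbf{f}=(f_1,\dots,f_n)\in\mathcal{S}^{Lip}(I)^n$, and $a\in I^n$. Consider the mapping $\mathbf{A}_{\mathbf{f}}:=(\mathscr{A}_{f_1},\dots,\mathscr{A}_{f_n})\colon I^n\to I^n$. Then either the iteration process of $\mathbf{A}_{\mathbf{f}}$ is degenerated, or $$\lim_{k\to\infty}\frac{\mathrm{Var}\,\mathbf{A}_{\mathbf{f}}^{k+1}(a)}{\big(\mathrm{Var}\,\mathbf{A}_{\mathbf{f}}^{k}(a)\big)^2}=\frac{\mathrm{Var}\big(P_{\mathbf{f}}(\mathscr{A}_\otimes(a))\big)}{4}.$$
   Context: For a vector $v=(v_1,\dots,v_n)\in\mathbb{R}^n$: $\overline{v}=\frac1n\sum_{i=1}^n v_i$ and $\mathrm{Var}(v)=\frac1n\sum_{i=1}^n(v_i-\overline{v})^2$. For a continuous strictly monotone $f\colon I\to\mathbb{R}$ and $a\in I^n$, the quasi-arithmetic mean is $\mathscr{A}_f(a)=f^{-1}\big(\frac1n\sum_{i=1}^n f(a_i)\big)$. For $\mathbf{f}=(f_1,\dots,f_n)$, $\mathbf{A}_{\mathbf{f}}(a)=(\mathscr{A}_{f_1}(a),\dots,\mathscr{A}_{f_n}(a))$, and $\mathbf{A}_{\mathbf{f}}^k$ is its $k$-th iterate. For a twice differentiable $f$ with nowhere vanishing first derivative, $P_f:=f''/f'$; and $P_{\mathbf{f}}(x)=(P_{f_1}(x),\dots,P_{f_n}(x))\in\mathbb{R}^n$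 for $x\in I$. $\mathcal{S}^{Lip}(I)$ is the set of $f\in\mathcal{C}^2(I)$ such that $f'\neq0$ everywhere on $I$, $f''$ has bounded variation on every compact subinterval of $I$, and $f''$ is locally Lipschitz. It is known that for every $a\in I^n$ all the coordinates $[\mathbf{A}_{\mathbf{f}}^k(a)]_i$, $i=1,\dots,n$, converge as $k\to\infty$ to a common limit; this limit is denoted $\mathscr{A}_\otimes(a)$ (the Gaussian product of $\mathscr{A}_{f_1},\dots,\mathscr{A}_{f_n}$; equivalently, $\mathscr{A}_\otimes\colon I^n\to I$ is the unique continuous strict mean with $\mathscr{A}_\otimes\circ\mathbf{A}_{\mathbf{f}}=\mathscr{A}_\otimes$). The iteration process of $\mathbf{A}_{\mathbf{f}}$ is called degenerated if there exist a nonconstant vector $v\in I^n$ and $k_0\in\mathbb{N}$ such that $\mathbf{A}_{\mathbf{f}}^{k_0}(v)$ is a constant vector (all entries equal). *)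

theory Defs
  imports "HOL-Analysis.Analysis"
begin

definition vec_mean :: "real ^ 'n \<Rightarrow> real" where
  "vec_mean v = (\<Sum>i\<in>UNIV. v $ i) / real CARD('n)"

definition Var :: "real ^ 'n \<Rightarrow> real" where
  "Var v = (\<Sum>i\<in>UNIV. (v $ i - vec_mean v)\<^sup>2) / real CARD('n)"

definition constant_vec :: "real ^ 'n \<Rightarrow> bool" where
  "constant_vec v \<longleftrightarrow> (\<forall>i j. v $ i = v $ j)"

definition in_power :: "real set \<Rightarrow> real ^ 'n \<Rightarrow> bool" where
  "in_power I v \<longleftrightarrow> (\<forall>i. v $ i \<in> I)"

(* Derivative relative to I: one-sided at endpoints belonging to I, and independent of
   the values of f outside I. *)
definition deriv_on :: "real set \<Rightarrow> (real \<Rightarrow> real) \<Rightarrow> real \<Rightarrow> real" where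
  "deriv_on I f x = vector_derivative f (at x within I)"

definition C2_on :: "real set \<Rightarrow> (real \<Rightarrow> real) \<Rightarrow> bool" where
  "C2_on I f \<longleftrightarrow> f differentiable_on I \<and> deriv_on I f differentiable_on I \<and>
     continuous_on I (deriv_on I (deriv_on I f))"

definition bounded_variation_on :: "real \<Rightarrow> real \<Rightarrow> (real \<Rightarrow> real) \<Rightarrow> bool" where
  "bounded_variation_on c d g \<longleftrightarrow>
     (\<exists>M. \<forall>m (t :: nat \<Rightarrow> real).
        (\<forall>i\<le>m. t i \<in> {c..d}) \<and> (\<forall>i<m. t i \<le> t (Suc i)) \<longrightarrow>
        (\<Sum>i<m. \<bar>g (t (Suc i)) - g (t i)\<bar>) \<le> M)"

definition locally_lipschitz_on :: "real set \<Rightarrow> (real \<Rightarrow> real) \<Rightarrow> bool" where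
  "locally_lipschitz_on I g \<longleftrightarrow>
     (\<forall>x\<in>I. \<exists>r>0. \<exists>L. L-lipschitz_on (cball x r \<inter> I) g)"

definition S_Lip :: "real set \<Rightarrow> (real \<Rightarrow> real) set" where
  "S_Lip I = {f. C2_on I f \<and> (\<forall>x\<in>I. deriv_on I f x \<noteq> 0) \<and>
     (\<forall>c d. {c..d} \<subseteq> I \<longrightarrow> bounded_variation_on c d (deriv_on I (deriv_on I f))) \<and>
     locally_lipschitz_on I (deriv_on I (deriv_on I f))}"

definition P_op :: "real set \<Rightarrow> (real \<Rightarrow> real) \<Rightarrow> real \<Rightarrow> real" where
  "P_op I f x = deriv_on I (deriv_on I f) x / deriv_on I f x"

definition P_vec :: "real set \<Rightarrow> ('n \<Rightarrow> real \<Rightarrow> real) \<Rightarrow> real \<Rightarrow> real ^ 'n" where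
  "P_vec I f x = (\<chi> i. P_op I (f i) x)"

definition qa_mean :: "real set \<Rightarrow> (real \<Rightarrow> real) \<Rightarrow> real ^ 'n \<Rightarrow> real" where
  "qa_mean I f a = the_inv_into I f ((\<Sum>i\<in>UNIV. f (a $ i)) / real CARD('n))"

definition qa_map :: "real set \<Rightarrow> ('n \<Rightarrow> real \<Rightarrow> real) \<Rightarrow> real ^ 'n \<Rightarrow> real ^ 'n" where
  "qa_map I f a = (\<chi> i. qa_mean I (f i) a)"

definition gauss_product :: "real set \<Rightarrow> ('n::finite \<Rightarrow> real \<Rightarrow> real) \<Rightarrow> real ^ 'n \<Rightarrow> real" where
  "gauss_product I f a = (THE l. \<forall>i. (\<lambda>k. ((qa_map I f ^^ k) a) $ i) \<longlonglongrightarrow> l)"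

definition degenerated :: "real set \<Rightarrow> ('n::finite \<Rightarrow> real \<Rightarrow> real) \<Rightarrow> bool" where
  "degenerated I f \<longleftrightarrow>
     (\<exists>v :: real ^ 'n. \<exists>k0. in_power I v \<and> \<not> constant_vec v \<and>
        constant_vec ((qa_map I f ^^ k0) v))"

end

theory Submission
  imports Defs
begin

text \<open>
  Two facts about a single quasi-arithmetic mean \<open>A\<^sub>f\<close> carry the proof.

  First, by the mean value theorem \<open>A\<^sub>f(v)\<close> is a weighted arithmetic mean of the entries of
  \<open>v\<close>, whose weights \<open>\<bar>f' z\<^sub>i\<bar>\<close> are bounded above and away from zero on a compact interval
  (\<open>qa_mean_weighted\<close>). Hence every step of the iteration shrinks the spread \<open>max v - min v\<close>
  by a fixed factor below one, and the entries of the iterates converge to a common limit \<open>l\<close>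
  (\<open>qa_map_iterates_converge\<close>). This limit is the Gaussian product.

  Second, expand \<open>f\<close> to second order at the arithmetic mean \<open>m\<close> of \<open>v\<close> and average over the
  entries. The linear terms cancel and the quadratic terms add up to
  \<open>f''(l) / 2 \<cdot> Var v\<close>, with an error that is \<open>o(Var v)\<close> as \<open>v\<close> shrinks to \<open>l\<close>. Dividing by
  \<open>f'\<close> gives \<open>(A\<^sub>f(v) - m) / Var v \<longlonglongrightarrow> P\<^sub>f(l) / 2\<close> (\<open>qa_mean_asymptotics\<close>).

  The numbers \<open>m\<close> and \<open>Var v\<close> are the same for all the generators. As the variance is invariant under
  translation and quadratic under scaling, \<open>Var (A v) / (Var v)\<^sup>2\<close> is the variance of the
  vector of these quotients, and by continuity it tends to \<open>Var (P(l) / 2) = Var (P(l)) / 4\<close>.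
  If the process is not degenerated, no iterate of a nonconstant vector is constant, so that
  no denominator vanishes.
\<close>

section \<open>Variance\<close>

lemma sum_deviation_eq_0: "(\<Sum>i\<in>UNIV. v $ i - vec_mean v) = 0" for v :: "real ^ 'n::finite"
  by (simp add: vec_mean_def sum_subtractf)

lemma sum_sq_deviation: "(\<Sum>i\<in>UNIV. (v $ i - vec_mean v)\<^sup>2) = real CARD('n) * Var v"
  for v :: "real ^ 'n::finite"
  by (simp add: Var_def)

lemma Var_pos_iff: "0 < Var v \<longleftrightarrow> \<not> constant_vec v" for v :: "real ^ 'n::finite"
proof -
  have nn: "0 \<le> Var v" unfolding Var_def by (intro divide_nonneg_nonneg sum_nonneg) auto
  have "Var v = 0 \<longleftrightarrow> (\<forall>i. v $ i = vec_mean v)"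
    by (simp add: Var_def sum_nonneg_eq_0_iff)
  also have "\<dots> \<longleftrightarrow> constant_vec v"
  proof
    assume "constant_vec v"
    then have "v $ j = v $ i" for i j by (simp add: constant_vec_def)
    then have "(\<Sum>j\<in>UNIV. v $ j) = (\<Sum>j\<in>(UNIV :: 'n set). v $ i)" for i
      by (intro sum.cong) auto
    then show "\<forall>i. v $ i = vec_mean v"
      unfolding vec_mean_def by (metis nonzero_mult_div_cancel_left of_nat_eq_0_iff card_eq_0_iff
          finite UNIV_not_empty sum_constant)
  qed (simp add: constant_vec_def)
  finally show ?thesis using nn by linarith
qed

lemma Var_affine: "Var (\<chi> i. (v $ i - b) / c) = Var v / c\<^sup>2" for v :: "real ^ 'n::finite"
proof -
  have "vec_mean (\<chi> i. (v $ i - b) / c) = (vec_mean v - b) / c"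
    by (simp add: vec_mean_def sum_subtractf sum_divide_distrib[symmetric] diff_divide_distrib)
  then have "((v $ i - b) / c - vec_mean (\<chi> i. (v $ i - b) / c))\<^sup>2 = (v $ i - vec_mean v)\<^sup>2 / c\<^sup>2" for i
    by (simp add: power_divide[symmetric] diff_divide_distrib)
  then show ?thesis
    by (simp add: Var_def sum_divide_distrib[symmetric])
qed

lemma tendsto_Var:
  fixes v :: "'b \<Rightarrow> real ^ 'n::finite"
  assumes "(v \<longlongrightarrow> w) F"
  shows "((\<lambda>k. Var (v k)) \<longlongrightarrow> Var w) F"
  unfolding Var_def vec_mean_def using assms by (intro tendsto_intros) auto

lemma arithmetic_mean_in_convex:
  fixes x :: "'n::finite \<Rightarrow> real"
  assumes "convex S" "\<And>i. x i \<in> S"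
  shows "(\<Sum>i\<in>UNIV. x i) / real CARD('n) \<in> S"
proof -
  have "(\<Sum>i\<in>UNIV. (1 / real CARD('n)) *\<^sub>R x i) \<in> S"
    using assms by (intro convex_sum) auto
  then show ?thesis by (simp add: sum_divide_distrib)
qed

section \<open>Quasi-arithmetic means with a twice continuously differentiable generator\<close>

text \<open>
  The derivatives are parameters, taken relative to \<open>I\<close>, so that endpoints belonging to \<open>I\<close>
  are treated like interior points.
\<close>

locale C2_generator =
  fixes I :: "real set" and f f' f'' :: "real \<Rightarrow> real"
  assumes interval: "is_interval I"
    and f': "\<And>x. x \<in> I \<Longrightarrow> (f has_real_derivative f' x) (at x within I)"
    and f'': "\<And>x. x \<in> I \<Longrightarrow> (f' has_real_derivative f'' x) (at x within I)"
    and continuous_f'': "continuous_on I f''"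
    and f'_nonzero: "\<And>x. x \<in> I \<Longrightarrow> f' x \<noteq> 0"
begin

lemma continuous_f: "continuous_on I f"
  using f' by (meson DERIV_continuous_on)

lemma continuous_f': "continuous_on I f'"
  using f'' by (meson DERIV_continuous_on)

lemma segment_subset: "x \<in> I \<Longrightarrow> y \<in> I \<Longrightarrow> closed_segment x y \<subseteq> I"
  using interval by (simp add: closed_segment_subset is_interval_convex_1)

lemma mean_value:
  assumes "x \<in> I" "y \<in> I"
  shows "\<exists>z\<in>closed_segment x y. f y - f x = f' z * (y - x)"
proof -
  have *: "\<exists>z\<in>{u..w}. f w - f u = f' z * (w - u)" if "u < w" "u \<in> I" "w \<in> I" for u w
  proof -
    have "{u..w} \<subseteq> I" using segment_subset[of u w] that by (simp add: closed_segment_eq_real_ivl)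
    then have "(f has_derivative (*) (f' z)) (at z within {u..w})" if "z \<in> {u..w}" for z
      using f'[of z] that by (meson DERIV_subset has_field_derivative_def subsetD)
    then obtain z where "z \<in> {u<..<w}" "f w - f u = f' z * (w - u)"
      using mvt_simple[OF \<open>u < w\<close>, of f "\<lambda>z. (*) (f' z)"] by auto
    then show ?thesis by (intro bexI[of _ z]) auto
  qed
  consider "x < y" | "x = y" | "y < x" by linarith
  then show ?thesis
  proof cases
    case 1 then show ?thesis using *[of x y] assms by (simp add: closed_segment_eq_real_ivl)
  next
    case 2 then show ?thesis by auto
  next
    case 3 
    then obtain z where "z \<in> {y..x}" "f x - f y = f' z * (x - y)" using *[of y x] assms by auto
    then show ?thesis using 3
      by (intro bexI[of _ z]) (auto simp: closed_segment_eq_real_ivl algebra_simps)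
  qed
qed

lemma inj_on_f: "inj_on f I"
proof (rule inj_onI)
  fix x y assume *: "x \<in> I" "y \<in> I" "f x = f y"
  then obtain z where "z \<in> closed_segment x y" "f y - f x = f' z * (y - x)"
    using mean_value by blast
  with * f'_nonzero[of z] segment_subset[of x y] show "x = y" by auto
qed

lemma f'_same_sign:
  assumes "x \<in> I" "y \<in> I"
  shows "0 < f' x * f' y"
proof (rule ccontr)
  assume "\<not> 0 < f' x * f' y"
  then have "f' x \<le> 0 \<and> 0 \<le> f' y \<or> f' y \<le> 0 \<and> 0 \<le> f' x"
    by (auto simp: not_less mult_le_0_iff)
  moreover have "connected (f' ` I)"
    using continuous_f' interval is_interval_connected_1 connected_continuous_image by blast
  ultimately have "0 \<in> f' ` I"
    using connectedD_interval[of "f' ` I" "f' x" "f' y" 0] connectedD_interval[of "f' ` I" "f' y" "f' x" 0]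
      assms by blast
  with f'_nonzero show False by auto
qed

text \<open>
  By the intermediate value theorem the mean of the values \<open>f (v $ i)\<close> is itself a value of \<open>f\<close>
  on \<open>J\<close>. Allowing any convex \<open>J \<subseteq> I\<close>, and not just \<open>I\<close>, localises the mean: near the limit
  point \<open>J\<close> will be a small ball, and in the contraction estimate a compact interval.
\<close>

lemma qa_mean_in_convex:
  fixes v :: "real ^ 'n::finite"
  assumes "convex J" "J \<subseteq> I" "in_power J v"
  shows "qa_mean I f v \<in> J"
    and f_qa_mean: "f (qa_mean I f v) = (\<Sum>i\<in>UNIV. f (v $ i)) / real CARD('n)"
proof -
  have "connected (f ` J)"
    using assms continuous_f continuous_on_subset connected_continuous_image convex_connected by blast
  then have "convex (f ` J)" by (simp flip: is_interval_convex_1 add: is_interval_connected_1)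
  then have "(\<Sum>i\<in>UNIV. f (v $ i)) / real CARD('n) \<in> f ` J"
    using assms(3) by (intro arithmetic_mean_in_convex) (auto simp: in_power_def)
  then obtain y where y: "y \<in> J" "f y = (\<Sum>i\<in>UNIV. f (v $ i)) / real CARD('n)"
    by (metis imageE)
  with assms(2) have "qa_mean I f v = y"
    unfolding qa_mean_def using inj_on_f by (metis subsetD the_inv_into_f_f)
  with y show "qa_mean I f v \<in> J" "f (qa_mean I f v) = (\<Sum>i\<in>UNIV. f (v $ i)) / real CARD('n)"
    by auto
qed

text \<open>
  The deviations \<open>f (v $ i) - f y\<close> from the mean value sum to zero. The mean value theorem
  turns each into \<open>f' (z i) * (v $ i - y)\<close>, and the common sign of \<open>f'\<close> can be divided out.
\<close>

lemma qa_mean_weighted: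
  fixes v :: "real ^ 'n::finite"
  assumes "convex J" "J \<subseteq> I" "in_power J v"
  shows "\<exists>z. (\<forall>i. z i \<in> J) \<and> (\<Sum>i\<in>UNIV. \<bar>f' (z i)\<bar> * (v $ i - qa_mean I f v)) = 0"
proof -
  define y where "y = qa_mean I f v"
  have yJ: "y \<in> J" using qa_mean_in_convex[OF assms] by (simp add: y_def)
  have vJ: "v $ i \<in> J" for i using assms by (auto simp: in_power_def)
  have "\<exists>z\<in>J. f (v $ i) - f y = f' z * (v $ i - y)" for i
    using mean_value[of y "v $ i"] closed_segment_subset[of y J "v $ i"] yJ vJ[of i] assms(1,2)
    by blast
  then obtain z where z: "\<And>i. z i \<in> J" "\<And>i. f (v $ i) - f y = f' (z i) * (v $ i - y)" by metis
  have "0 < f' y * f' (z i)" for i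
    using yJ z(1)[of i] assms(2) by (intro f'_same_sign) auto
  then have "\<bar>f' (z i)\<bar> = sgn (f' y) * f' (z i)" for i
    unfolding zero_less_mult_iff by (metis abs_of_neg abs_of_pos mult_1 mult_minus1 sgn_neg sgn_pos)
  then have "(\<Sum>i\<in>UNIV. \<bar>f' (z i)\<bar> * (v $ i - y)) = sgn (f' y) * (\<Sum>i\<in>UNIV. f (v $ i) - f y)"
    by (simp add: sum_distrib_left z(2) mult.assoc)
  also have "(\<Sum>i\<in>UNIV. f (v $ i) - f y) = 0"
    using f_qa_mean[OF assms] by (simp add: sum_subtractf y_def)
  finally show ?thesis using z(1) by (auto simp: y_def)
qed

text \<open>
  The largest entry \<open>q\<close> has a weight that is bounded below, which lifts the mean off \<open>p\<close> by a
  fixed fraction of \<open>q - p\<close>. A one-sided gain suffices to shrink the spread. As \<open>c\<close> is chosen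
  before \<open>v\<close>, it serves for all iterates at once.
\<close>

lemma qa_mean_contraction:
  assumes "{lo..hi} \<subseteq> I" "lo \<le> hi"
  shows "\<exists>c>0. c \<le> 1 \<and> (\<forall>(v::real ^ 'n::finite) p q. lo \<le> p \<longrightarrow> q \<le> hi \<longrightarrow> in_power {p..q} v \<longrightarrow>
           (\<exists>j. v $ j = q) \<longrightarrow> qa_mean I f v \<in> {p + c * (q - p)..q})"
proof -
  have cont: "continuous_on {lo..hi} (\<lambda>x. \<bar>f' x\<bar>)"
    using continuous_f' assms(1) continuous_on_subset by (intro continuous_intros) blast
  obtain x1 where x1: "x1 \<in> {lo..hi}" "\<And>x. x \<in> {lo..hi} \<Longrightarrow> \<bar>f' x1\<bar> \<le> \<bar>f' x\<bar>"
    using continuous_attains_inf[OF _ _ cont] assms by auto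
  obtain x2 where x2: "x2 \<in> {lo..hi}" "\<And>x. x \<in> {lo..hi} \<Longrightarrow> \<bar>f' x\<bar> \<le> \<bar>f' x2\<bar>"
    using continuous_attains_sup[OF _ _ cont] assms by auto
  define b B c where "b = \<bar>f' x1\<bar>" and "B = \<bar>f' x2\<bar>" and "c = b / (real CARD('n) * B)"
  have bB: "0 < b" "b \<le> B" using f'_nonzero x1 x2 assms by (auto simp: b_def B_def)
  have n1: "real CARD('n) \<ge> 1" by (simp add: Suc_leI)
  then have nB: "B \<le> real CARD('n) * B" using bB by (simp add: mult_le_cancel_right1)
  have c: "0 < c" "c \<le> 1" using bB order_trans[OF bB(2) nB] by (auto simp: c_def)
  have "qa_mean I f v \<in> {p + c * (q - p)..q}"
    if pq: "lo \<le> p" "q \<le> hi" and v: "in_power {p..q} v" and j: "v $ j = q" for v :: "real ^ 'n" and p q j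
  proof -
    define y where "y = qa_mean I f v"
    have J: "convex {p..q}" "{p..q} \<subseteq> I" using pq assms by auto
    have y: "y \<in> {p..q}" using qa_mean_in_convex[OF J v] by (simp add: y_def)
    obtain z where z: "\<And>i. z i \<in> {p..q}" "(\<Sum>i\<in>UNIV. \<bar>f' (z i)\<bar> * (v $ i - y)) = 0"
      using qa_mean_weighted[OF J v] by (auto simp: y_def)
    have w: "b \<le> \<bar>f' (z i)\<bar>" "\<bar>f' (z i)\<bar> \<le> B" for i
      using x1(2)[of "z i"] x2(2)[of "z i"] z(1)[of i] pq by (auto simp: b_def B_def)
    have "b * (q - p) \<le> \<bar>f' (z j)\<bar> * (v $ j - p)"
      using w y j by (intro mult_mono) auto
    also have "\<dots> \<le> (\<Sum>i\<in>UNIV. \<bar>f' (z i)\<bar> * (v $ i - p))"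
      using v by (intro member_le_sum) (auto simp: in_power_def)
    also have "\<dots> = (\<Sum>i\<in>UNIV. \<bar>f' (z i)\<bar> * (v $ i - y) + \<bar>f' (z i)\<bar> * (y - p))"
      by (intro sum.cong) (auto simp: algebra_simps)
    also have "\<dots> = (\<Sum>i\<in>UNIV. \<bar>f' (z i)\<bar> * (v $ i - y)) + (\<Sum>i\<in>UNIV. \<bar>f' (z i)\<bar>) * (y - p)"
      by (simp only: sum.distrib sum_distrib_right)
    also have "\<dots> \<le> (real CARD('n) * B) * (y - p)"
      using z(2) y sum_bounded_above[of UNIV "\<lambda>i. \<bar>f' (z i)\<bar>" B] w by (auto intro: mult_right_mono)
    finally have "c * (q - p) \<le> y - p"
      using bB nB by (simp add: c_def field_simps)
    with y show ?thesis by (auto simp: y_def)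
  qed
  with c show ?thesis by blast
qed

text \<open>
  The quadratic coefficient is fixed at \<open>l\<close> while the base point \<open>m\<close> moves, as the arithmetic
  means of the iterates do. Applying the mean value inequality first to \<open>f'\<close> and then to \<open>f\<close> itself
  bounds the remainder by the oscillation of \<open>f''\<close> near \<open>l\<close>.
\<close>

lemma second_order_expansion:
  assumes "l \<in> I" "0 < e"
  shows "\<exists>r>0. \<forall>x\<in>I \<inter> ball l r. \<forall>m\<in>I \<inter> ball l r.
           \<bar>f x - f m - f' m * (x - m) - f'' l / 2 * (x - m)\<^sup>2\<bar> \<le> e * (x - m)\<^sup>2"
proof -
  obtain r where r: "r > 0" "\<And>x. x \<in> I \<Longrightarrow> dist x l < r \<Longrightarrow> dist (f'' x) (f'' l) < e"
    using continuous_f'' assms unfolding continuous_on_iff by blast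
  have "\<bar>f x - f m - f' m * (x - m) - f'' l / 2 * (x - m)\<^sup>2\<bar> \<le> e * (x - m)\<^sup>2"
    if x: "x \<in> I \<inter> ball l r" and m: "m \<in> I \<inter> ball l r" for x m
  proof -
    define S where "S = closed_segment m x"
    have conv: "convex (I \<inter> ball l r)"
      using interval by (intro convex_Int) (auto simp: is_interval_convex_1)
    have S: "S \<subseteq> I \<inter> ball l r" "convex S" "m \<in> S" "x \<in> S"
      using closed_segment_subset[OF m x conv] by (auto simp: S_def)
    have near: "\<bar>f'' z - f'' l\<bar> \<le> e" if "z \<in> S" for z
      using r(2)[of z] S(1) that by (force simp: dist_real_def abs_minus_commute)
    have slope: "\<bar>f' z - f' m - f'' l * (z - m)\<bar> \<le> e * \<bar>x - m\<bar>" if z: "z \<in> S" for z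
    proof -
      have "norm ((f' z - f'' l * z) - (f' m - f'' l * m)) \<le> e * norm (z - m)"
      proof (rule field_differentiable_bound[OF S(2), where f' = "\<lambda>w. f'' w - f'' l"])
        fix w assume "w \<in> S"
        then have "(f' has_real_derivative f'' w) (at w within S)"
          using f''[of w] S(1) by (meson DERIV_subset Int_lower1 subset_trans subsetD)
        then show "((\<lambda>w. f' w - f'' l * w) has_real_derivative f'' w - f'' l) (at w within S)"
          by (auto intro!: derivative_eq_intros)
      qed (use near S z in auto)
      also have "\<dots> \<le> e * \<bar>x - m\<bar>"
        using z assms(2) by (intro mult_left_mono) (auto simp: S_def closed_segment_eq_real_ivl split: if_splits)
      finally show ?thesis by (simp add: algebra_simps)
    qed
    let ?g = "\<lambda>z. f z - f' m * (z - m) - f'' l / 2 * (z - m)\<^sup>2"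
    have "norm (?g x - ?g m) \<le> (e * \<bar>x - m\<bar>) * norm (x - m)"
    proof (rule field_differentiable_bound[OF S(2), where f' = "\<lambda>z. f' z - f' m - f'' l * (z - m)"])
      fix z assume "z \<in> S"
      then have "(f has_real_derivative f' z) (at z within S)"
        using f'[of z] S(1) by (meson DERIV_subset Int_lower1 subset_trans subsetD)
      then show "(?g has_real_derivative f' z - f' m - f'' l * (z - m)) (at z within S)"
        by (auto intro!: derivative_eq_intros)
    qed (use slope S in auto)
    then show ?thesis by (simp add: power2_eq_square algebra_simps)
  qed
  with r(1) show ?thesis by blast
qed

text \<open>
  Averaging the expansion at the arithmetic mean over the entries yields the limit of
  \<open>(f y - f m) / Var v\<close>, where \<open>y\<close> is the quasi-arithmetic and \<open>m\<close> the arithmetic mean. The mean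
  value theorem then replaces \<open>f y - f m\<close> by \<open>f' z * (y - m)\<close> with \<open>z\<close> tending to \<open>l\<close>.
\<close>

lemma qa_mean_asymptotics:
  fixes v :: "nat \<Rightarrow> real ^ 'n::finite"
  assumes "l \<in> I" and v: "\<And>k. in_power I (v k)" and lim: "\<And>i. (\<lambda>k. v k $ i) \<longlonglongrightarrow> l"
    and nonconst: "\<And>k. 0 < Var (v k)"
  shows "(\<lambda>k. (qa_mean I f (v k) - vec_mean (v k)) / Var (v k)) \<longlonglongrightarrow> f'' l / f' l / 2"
proof -
  define y m where "y k = qa_mean I f (v k)" and "m k = vec_mean (v k)" for k
  have convI: "convex I" using interval by (simp add: is_interval_convex_1)
  have near: "\<forall>\<^sub>F k in sequentially. in_power (I \<inter> ball l e) (v k) \<and> y k \<in> I \<inter> ball l e \<and> m k \<in> I \<inter> ball l e"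
    if "0 < e" for e
  proof -
    have "\<forall>\<^sub>F k in sequentially. \<forall>i. dist (v k $ i) l < e"
      using lim that by (intro eventually_all_finite tendstoD) auto
    then show ?thesis
    proof eventually_elim
      case (elim k)
      have J: "convex (I \<inter> ball l e)" "I \<inter> ball l e \<subseteq> I" using convI by (auto intro: convex_Int)
      have p: "in_power (I \<inter> ball l e) (v k)"
        using elim v[of k] by (auto simp: in_power_def dist_commute)
      have "m k \<in> I \<inter> ball l e"
        unfolding m_def vec_mean_def
        using p by (intro arithmetic_mean_in_convex[OF J(1)]) (auto simp: in_power_def)
      then show ?case using p qa_mean_in_convex[OF J p] by (simp add: y_def)
    qed
  qed
  have yI: "y k \<in> I" for k unfolding y_def by (rule qa_mean_in_convex[OF convI order_refl v])
  have mI: "m k \<in> I" for k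
    unfolding m_def vec_mean_def
    using v[of k] by (intro arithmetic_mean_in_convex[OF convI]) (auto simp: in_power_def)
  have quotient: "(\<lambda>k. (f (y k) - f (m k)) / Var (v k)) \<longlonglongrightarrow> f'' l / 2"
  proof (rule tendstoI)
    fix e :: real assume "0 < e"
    then obtain r where r: "r > 0" "\<And>x m. x \<in> I \<inter> ball l r \<Longrightarrow> m \<in> I \<inter> ball l r \<Longrightarrow>
           \<bar>f x - f m - f' m * (x - m) - f'' l / 2 * (x - m)\<^sup>2\<bar> \<le> e / 2 * (x - m)\<^sup>2"
      using second_order_expansion[OF assms(1), of "e / 2"] by auto
    show "\<forall>\<^sub>F k in sequentially. dist ((f (y k) - f (m k)) / Var (v k)) (f'' l / 2) < e"
      using near[OF r(1)]
    proof eventually_elim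
      case (elim k)
      let ?n = "real CARD('n)" and ?V = "Var (v k)"
      define d where "d i = v k $ i - m k" for i
      have d0: "(\<Sum>i\<in>UNIV. d i) = 0" and d2: "(\<Sum>i\<in>UNIV. (d i)\<^sup>2) = ?n * ?V"
        by (simp_all add: d_def m_def sum_deviation_eq_0 sum_sq_deviation)
      have fy: "(\<Sum>i\<in>UNIV. f (v k $ i)) = ?n * f (y k)"
        using f_qa_mean[OF convI order_refl v[of k]] by (simp add: y_def)
      have "\<bar>\<Sum>i\<in>UNIV. f (v k $ i) - f (m k) - f' (m k) * d i - f'' l / 2 * (d i)\<^sup>2\<bar>
              \<le> (\<Sum>i\<in>UNIV. e / 2 * (d i)\<^sup>2)"
        using elim unfolding d_def
        by (intro order_trans[OF sum_abs sum_mono] r(2)) (auto simp: in_power_def)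
      also have "\<dots> = ?n * (e / 2 * ?V)"
        by (simp only: sum_distrib_left[symmetric] d2) simp
      also have "(\<Sum>i\<in>UNIV. f (v k $ i) - f (m k) - f' (m k) * d i - f'' l / 2 * (d i)\<^sup>2)
                  = ?n * (f (y k) - f (m k) - f'' l / 2 * ?V)"
        by (simp only: sum_subtractf sum_distrib_left[symmetric] d0 d2 fy) (simp add: algebra_simps)
      finally have "?n * \<bar>f (y k) - f (m k) - f'' l / 2 * ?V\<bar> \<le> ?n * (e / 2 * ?V)"
        by (simp add: abs_mult)
      then have "\<bar>f (y k) - f (m k) - f'' l / 2 * ?V\<bar> \<le> e / 2 * ?V"
        by (subst (asm) mult_le_cancel_left_pos) auto
      also have "\<dots> < e * ?V" using \<open>0 < e\<close> nonconst[of k] by simp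
      finally have "\<bar>f (y k) - f (m k) - f'' l / 2 * ?V\<bar> / ?V < e"
        using nonconst[of k] by (simp add: divide_simps)
      moreover have "(f (y k) - f (m k)) / ?V - f'' l / 2 = (f (y k) - f (m k) - f'' l / 2 * ?V) / ?V"
        using nonconst[of k] by (simp add: diff_divide_distrib)
      ultimately show ?case using nonconst[of k] by (simp add: dist_real_def abs_divide)
    qed
  qed
  have "\<exists>z\<in>closed_segment (m k) (y k). f (y k) - f (m k) = f' z * (y k - m k)" for k
    using mean_value[OF mI yI] .
  then obtain z where z: "\<And>k. z k \<in> closed_segment (m k) (y k)"
      "\<And>k. f (y k) - f (m k) = f' (z k) * (y k - m k)" by metis
  have zI: "z k \<in> I" for k using z(1) segment_subset[OF mI yI] by blast
  have "z \<longlonglongrightarrow> l"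
  proof (rule tendstoI)
    fix e :: real assume "0 < e"
    show "\<forall>\<^sub>F k in sequentially. dist (z k) l < e"
      using near[OF \<open>0 < e\<close>]
    proof eventually_elim
      case (elim k)
      then have "closed_segment (m k) (y k) \<subseteq> ball l e"
        by (intro closed_segment_subset) auto
      with z(1)[of k] show ?case by (auto simp: dist_commute)
    qed
  qed
  then have "(\<lambda>k. f' (z k)) \<longlonglongrightarrow> f' l"
    using continuous_f' assms(1) zI by (intro continuous_on_tendsto_compose[of I f']) auto
  then have "(\<lambda>k. (f (y k) - f (m k)) / Var (v k) / f' (z k)) \<longlonglongrightarrow> f'' l / 2 / f' l"
    by (intro tendsto_divide quotient f'_nonzero assms(1))
  moreover have "(f (y k) - f (m k)) / Var (v k) / f' (z k) = (y k - m k) / Var (v k)" for k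
    using z(2)[of k] f'_nonzero[OF zI[of k]] by simp
  ultimately show ?thesis by (simp add: y_def m_def mult.commute)
qed

end

lemma S_Lip_C2_generator:
  assumes "is_interval I" "f \<in> S_Lip I"
  shows "C2_generator I f (deriv_on I f) (deriv_on I (deriv_on I f))"
proof -
  have D: "(g has_real_derivative deriv_on I g x) (at x within I)"
    if "g differentiable_on I" "x \<in> I" for g x
    using that unfolding deriv_on_def differentiable_on_def
    by (simp add: has_real_derivative_iff_has_vector_derivative vector_derivative_works[symmetric])
  show ?thesis
    using assms D by unfold_locales (auto simp: S_Lip_def C2_on_def)
qed

section \<open>Convergence of the iteration\<close>

lemma qa_map_contraction:
  fixes f :: "'n::finite \<Rightarrow> real \<Rightarrow> real"
  assumes gen: "\<And>i. C2_generator I (f i) (f' i) (f'' i)" and "{lo..hi} \<subseteq> I" "lo \<le> hi"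
  shows "\<exists>c>0. c \<le> 1 \<and> (\<forall>(v::real ^ 'n) p q. lo \<le> p \<longrightarrow> q \<le> hi \<longrightarrow> in_power {p..q} v \<longrightarrow>
           (\<exists>j. v $ j = q) \<longrightarrow> in_power {p + c * (q - p)..q} (qa_map I f v))"
proof -
  have "\<forall>i. \<exists>c>0. c \<le> 1 \<and> (\<forall>(v::real ^ 'n) p q. lo \<le> p \<longrightarrow> q \<le> hi \<longrightarrow> in_power {p..q} v \<longrightarrow>
           (\<exists>j. v $ j = q) \<longrightarrow> qa_mean I (f i) v \<in> {p + c * (q - p)..q})"
    using C2_generator.qa_mean_contraction[OF gen assms(2,3)] by blast
  then obtain c where c: "\<And>i. 0 < c i" "\<And>i. c i \<le> 1" "\<And>i (v::real ^ 'n) p q. lo \<le> p \<Longrightarrow> q \<le> hi \<Longrightarrow>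
      in_power {p..q} v \<Longrightarrow> (\<exists>j. v $ j = q) \<Longrightarrow> qa_mean I (f i) v \<in> {p + c i * (q - p)..q}"
    by metis
  define d where "d = Min (range c)"
  have "d \<in> range c" unfolding d_def by (intro Min_in) auto
  then have d: "0 < d" "d \<le> 1" using c by auto
  have dc: "d \<le> c i" for i by (simp add: d_def)
  have "in_power {p + d * (q - p)..q} (qa_map I f v)"
    if h: "lo \<le> p" "q \<le> hi" "in_power {p..q} v" "\<exists>j. v $ j = q" for v :: "real ^ 'n" and p q
  proof -
    have "p \<le> q" using h(3,4) by (auto simp: in_power_def)
    then have "d * (q - p) \<le> c i * (q - p)" for i using dc by (intro mult_right_mono) auto
    then show ?thesis using c(3)[OF h] unfolding in_power_def qa_map_def
      by (simp add: Ball_def) (meson add_left_mono order_trans)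
  qed
  with d show ?thesis by blast
qed

text \<open>
  The intervals spanned by the entries of the iterates are nested, and their lengths decay
  geometrically, so they shrink to one point.
\<close>

lemma qa_map_iterates_converge:
  fixes f :: "'n::finite \<Rightarrow> real \<Rightarrow> real" and a :: "real ^ 'n"
  assumes gen: "\<And>i. C2_generator I (f i) (f' i) (f'' i)" and a: "in_power I a"
  shows "\<exists>l\<in>I. \<forall>i. (\<lambda>k. (qa_map I f ^^ k) a $ i) \<longlonglongrightarrow> l"
    and "in_power I ((qa_map I f ^^ k) a)"
proof -
  define lo hi where "lo v = Min (range (($) v))" and "hi v = Max (range (($) v))" for v :: "real ^ 'n"
  have lohi: "in_power {lo v..hi v} v" "\<exists>j. v $ j = lo v" "\<exists>j. v $ j = hi v" for v
  proof -
    have "lo v \<in> range (($) v)" "hi v \<in> range (($) v)" unfolding lo_def hi_def by (intro Min_in Max_in; simp)+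
    then show "\<exists>j. v $ j = lo v" "\<exists>j. v $ j = hi v" by (metis imageE)+
    show "in_power {lo v..hi v} v" by (simp add: in_power_def lo_def hi_def)
  qed
  have lo_in: "lo v \<in> S" and hi_in: "hi v \<in> S" if "in_power S v" for v S
  proof -
    obtain i j where ij: "v $ i = lo v" "v $ j = hi v" using lohi(2,3) by blast
    have "v $ i \<in> S" "v $ j \<in> S" using that by (auto simp: in_power_def)
    then show "lo v \<in> S" "hi v \<in> S" unfolding ij .
  qed
  have le: "lo v \<le> hi v" for v using lohi(1)[of v] by (auto simp: in_power_def)
  have "is_interval I" by (rule C2_generator.interval[OF gen])
  then have sub: "{lo a..hi a} \<subseteq> I"
    by (auto intro: mem_is_interval_1_I[OF _ lo_in[OF a] hi_in[OF a]])
  obtain c where c: "0 < c" "c \<le> 1" "\<And>(v::real ^ 'n) p q. lo a \<le> p \<Longrightarrow> q \<le> hi a \<Longrightarrow>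
      in_power {p..q} v \<Longrightarrow> (\<exists>j. v $ j = q) \<Longrightarrow> in_power {p + c * (q - p)..q} (qa_map I f v)"
    using qa_map_contraction[where f = f, OF gen sub le] by blast
  define v where "v k = (qa_map I f ^^ k) a" for k
  have step: "lo (v k) + c * (hi (v k) - lo (v k)) \<le> lo (v (Suc k)) \<and> hi (v (Suc k)) \<le> hi (v k)"
    if "lo a \<le> lo (v k)" "hi (v k) \<le> hi a" for k
  proof -
    have "in_power {lo (v k) + c * (hi (v k) - lo (v k))..hi (v k)} (v (Suc k))"
      using c(3)[OF that lohi(1,3)] by (simp add: v_def)
    from lo_in[OF this] hi_in[OF this] show ?thesis by auto
  qed
  have bounds: "lo a \<le> lo (v k) \<and> hi (v k) \<le> hi a" for k
  proof (induction k)
    case (Suc k)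
    moreover have "0 \<le> c * (hi (v k) - lo (v k))" using c(1) le[of "v k"] by simp
    ultimately show ?case using step[of k] by linarith
  qed (simp add: v_def)
  have mono: "lo (v k) \<le> lo (v (Suc k))" "hi (v (Suc k)) \<le> hi (v k)"
    and contr: "hi (v (Suc k)) - lo (v (Suc k)) \<le> (1 - c) * (hi (v k) - lo (v k))" for k
  proof -
    have "0 \<le> c * (hi (v k) - lo (v k))" using c(1) le[of "v k"] by simp
    then show "lo (v k) \<le> lo (v (Suc k))" "hi (v (Suc k)) \<le> hi (v k)"
      "hi (v (Suc k)) - lo (v (Suc k)) \<le> (1 - c) * (hi (v k) - lo (v k))"
      using step[of k] bounds[of k] by (auto simp: algebra_simps)
  qed
  have geom: "hi (v k) - lo (v k) \<le> (1 - c) ^ k * (hi a - lo a)" for k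
  proof (induction k)
    case (Suc k)
    then have "(1 - c) * (hi (v k) - lo (v k)) \<le> (1 - c) * ((1 - c) ^ k * (hi a - lo a))"
      using c(2) by (intro mult_left_mono) auto
    with contr[of k] show ?case by simp
  qed (simp add: v_def)
  have "(\<lambda>k. (1 - c) ^ k * (hi a - lo a)) \<longlonglongrightarrow> 0"
    using c(1,2) by (intro tendsto_mult_left_zero LIMSEQ_power_zero) auto
  from tendsto_sandwich[OF _ _ tendsto_const this] have "(\<lambda>k. hi (v k) - lo (v k)) \<longlonglongrightarrow> 0"
    using le geom by auto
  from tendsto_minus[OF this] have "(\<lambda>k. lo (v k) - hi (v k)) \<longlonglongrightarrow> 0" by simp
  then obtain l where l: "\<And>k. lo (v k) \<le> l" "(\<lambda>k. lo (v k)) \<longlonglongrightarrow> l"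
      "\<And>k. l \<le> hi (v k)" "(\<lambda>k. hi (v k)) \<longlonglongrightarrow> l"
    using nested_sequence_unique[of "\<lambda>k. lo (v k)" "\<lambda>k. hi (v k)"] mono le by blast
  have "(\<lambda>k. v k $ i) \<longlonglongrightarrow> l" for i
    by (rule tendsto_sandwich[OF _ _ l(2,4)]) (use lohi(1) in \<open>auto simp: in_power_def\<close>)
  moreover have "l \<in> I" using l(1,3)[of 0] sub by (auto simp: v_def)
  ultimately show "\<exists>l\<in>I. \<forall>i. (\<lambda>k. (qa_map I f ^^ k) a $ i) \<longlonglongrightarrow> l"
    by (auto simp: v_def)
  show "in_power I ((qa_map I f ^^ k) a)"
    using lohi(1)[of "v k"] bounds[of k] sub unfolding in_power_def v_def[symmetric]
    by (metis atLeastAtMost_iff order_trans subsetD)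
qed

lemma gauss_product_eqI:
  assumes "\<And>i. (\<lambda>k. (qa_map I f ^^ k) a $ i) \<longlonglongrightarrow> l"
  shows "gauss_product I f a = l"
  unfolding gauss_product_def using assms LIMSEQ_unique by (intro the_equality) blast+

section \<open>Quadratic decay of the variance\<close>

theorem corollary3p2:
  fixes I :: "real set" and f :: "'n::finite \<Rightarrow> real \<Rightarrow> real" and a :: "real ^ 'n"
  assumes "is_interval I"
    and "\<And>i. f i \<in> S_Lip I"
    and "in_power I a"
    and "\<not> constant_vec a"
  shows "degenerated I f \<or>
    ((\<lambda>k. Var ((qa_map I f ^^ Suc k) a) / (Var ((qa_map I f ^^ k) a))\<^sup>2)
       \<longlonglongrightarrow> Var (P_vec I f (gauss_product I f a)) / 4)"
proof (subst disj_imp, intro impI)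
  assume nondeg: "\<not> degenerated I f"
  define v where "v k = (qa_map I f ^^ k) a" for k
  have gen: "C2_generator I (f i) (deriv_on I (f i)) (deriv_on I (deriv_on I (f i)))" for i
    by (rule S_Lip_C2_generator[OF assms(1,2)])
  have "\<exists>l\<in>I. \<forall>i. (\<lambda>k. v k $ i) \<longlonglongrightarrow> l" and v_in: "in_power I (v k)" for k
    unfolding v_def by (rule qa_map_iterates_converge[OF _ assms(3)], rule gen)+
  then obtain l where l: "l \<in> I" "\<And>i. (\<lambda>k. v k $ i) \<longlonglongrightarrow> l" by blast
  have limit: "gauss_product I f a = l"
    using l(2) by (intro gauss_product_eqI) (simp add: v_def)
  have pos: "0 < Var (v k)" for k
    using nondeg assms(3,4) unfolding Var_pos_iff degenerated_def v_def by blast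
  \<comment> \<open>All coordinates are shifted and scaled alike, so \<open>Var (w k)\<close> is the ratio in question.\<close>
  define w where "w k = (\<chi> i. (v (Suc k) $ i - vec_mean (v k)) / Var (v k))" for k
  \<comment> \<open>The limit is written with the shift \<open>- 0\<close> to have the form required by \<open>Var_affine\<close>.\<close>
  have "(\<lambda>k. w k $ i) \<longlonglongrightarrow> (\<chi> i. (P_vec I f l $ i - 0) / 2) $ i" for i
    using C2_generator.qa_mean_asymptotics[OF gen l(1) v_in l(2) pos, of i]
    by (simp add: w_def v_def qa_map_def P_vec_def P_op_def)
  then have "(\<lambda>k. Var (w k)) \<longlonglongrightarrow> Var (\<chi> i. (P_vec I f l $ i - 0) / 2)"
    by (intro tendsto_Var vec_tendstoI)
  then show "(\<lambda>k. Var ((qa_map I f ^^ Suc k) a) / (Var ((qa_map I f ^^ k) a))\<^sup>2)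
       \<longlonglongrightarrow> Var (P_vec I f (gauss_product I f a)) / 4"
    unfolding w_def Var_affine limit v_def by simp
qed

end
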